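(* Let $n>1$ be an integer, $R>0$ a constant, and let $\alpha$ be a constant with $-1<\alpha\le\alpha_0:=\frac{n-1}{2}$. Let $1\le a<b\le\infty$, let $\psi$ be a generating function on $(a,b)$, and let $f\in G\psi(a,b)$. Put $q_0=\frac{n}{(n+1)/2+\alpha}$ and $$s=s(\alpha,n;r):=\min\left\{b,\ \frac{r q_0}{r q_0+q_0-r}\right\},\qquad d:=r_0(\alpha,n;b)=\frac{b\,q_0}{q_0+b-b\,q_0}.$$ For $r\in(d,\infty)$ (with $r\ge1$) let $\nu(r)$ be the generating function $$\nu(r)=\nu[\psi](\alpha,n,R;r):=\inf_{p\in(a,s)}\bigl[\,W(\alpha,n,R;p,r)\,\psi(p)\,\bigr],$$ where $$W(\alpha,n,R;p,r)=R^{\,n(1/p-1/r)}\,\bigl[q(p,r)-q_0\bigr]^{\,1/p-1-1/r},\qquad q(p,r)=\frac{pr}{pr+p-r}.$$ Then $$\|B_R^{\alpha}[f]\|_{G\nu}\le C(\alpha,n,R)\,\|f\|_{G\psi},$$ where the constant $C(\alpha,n,R)$ depends only on $\alpha$, $n$, $R$ and $G\nu$ is the Grand Lebesgue Space with generating function $\nu$ on the range $r\in(d,\infty)$, $r\ge1$.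
   Context: Grand Lebesgue Spaces: for $1\le a<b\le\infty$, a generating function on $(a,b)$ is a positive measurable function $\psi=\psi(p)$, $p\in(a,b)$, with $\inf_{p\in(a,b)}\psi(p)>0$. The space $G\psi=G\psi(a,b)$ consists of all measurable functions $f$ on $\mathbb{R}^n$ with finite norm $\|f\|_{G\psi}:=\sup_{p\in(a,b)}\frac{\|f\|_p}{\psi(p)}$, where $\|\cdot\|_p$ is the usual $L_p(\mathbb{R}^n)$ norm (convention: $C/\infty=0$). The norm $\|\cdot\|_{G\nu}$ is defined in the same way, with the supremum over the $r$ on which $\nu$ is defined. Standing restrictions on the exponents: $p>1$, $q,r\ge1$, $1+1/r=1/q+1/p$ (so $q=q(p,r)$), $q>q_0$, $p\le p_0:=(1-1/q_0)^{-1}$ ($p_0=\infty$ if $q_0=1$), and $r>r_0(\alpha,n;p):=\frac{p q_0}{p+q_0-pq_0}$. The infimum defining $\nu(r)$ is over $p\in(a,s)$ subject to these restrictions. If $b=p_0$ or $b=\infty$ the expression for $d$ is understood as the limit as $b'\uparrow b$ of the same expression with $b'$ in place of $b$. The Bochner-Riesz operator of order $\alpha>-1$ and parameter $R>0$ is the Fourier multiplier operator with symbol $\left(1-|y|^2/R^2\right)_+^{\alpha}$, where $z_+=\max(z,0)$. It is represented as a convolution $$B_R^{\alpha}[f](t)=\int_{\mathbb{R}^n} f(t-s)\,K_\lambda^R(s)\,ds,\qquad K_\lambda^R(z)=C(\alpha)\,R^n\,\frac{J_\lambda(R|z|)}{|Rz|^{\lambda}},\qquad \lambda=\alpha+\frac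 n2,$$ with $C(\alpha)=1/\Gamma(\alpha+1)$, $J_\lambda$ the Bessel function of the first kind of order $\lambda$ and $\Gamma$ the Gamma function. This convolution formula is taken as the definition of $B_R^\alpha$. *)

theory Defs
  imports "HOL-Analysis.Analysis"
begin

definition Lp_norm :: "real \<Rightarrow> (real^'n \<Rightarrow> complex) \<Rightarrow> ennreal" where
  "Lp_norm p f =
     (let I = \<integral>\<^sup>+ x. ennreal (norm (f x) powr p) \<partial>lebesgue
      in if I = \<infinity> then \<infinity> else ennreal (enn2real I powr (1 / p)))"

text \<open>Generating functions take values in \<^typ>\<open>ennreal\<close>: the infimum defining the
  function \<open>\<nu>\<close> below may be over an empty set, and then equals \<open>\<infinity>\<close>. Division by
  \<open>\<infinity>\<close> in \<^typ>\<open>ennreal\<close> yields \<open>0\<close>, which is the convention \<open>C / \<infinity> = 0\<close>.\<close>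

definition generating_function :: "real set \<Rightarrow> (real \<Rightarrow> ennreal) \<Rightarrow> bool" where
  "generating_function I \<psi> \<longleftrightarrow>
     \<psi> \<in> borel_measurable (lebesgue_on I) \<and> (\<forall>p\<in>I. \<psi> p > 0) \<and> (INF p\<in>I. \<psi> p) > 0"

definition GLS_norm :: "real set \<Rightarrow> (real \<Rightarrow> ennreal) \<Rightarrow> (real^'n \<Rightarrow> complex) \<Rightarrow> ennreal" where
  "GLS_norm I \<psi> f = (SUP p\<in>I. Lp_norm p f / \<psi> p)"

definition GLS :: "real set \<Rightarrow> (real \<Rightarrow> ennreal) \<Rightarrow> (real^'n \<Rightarrow> complex) set" where
  "GLS I \<psi> = {f \<in> borel_measurable lebesgue. GLS_norm I \<psi> f < \<infinity>}"

definition exponents :: "real \<Rightarrow> ereal \<Rightarrow> real set" where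
  "exponents a b = {p. a < p \<and> ereal p < b}"

text \<open>Bessel function of the first kind, for an argument \<open>x \<ge> 0\<close>; \<^const>\<open>rGamma\<close> is the
  entire function \<open>1 / \<Gamma>\<close>.\<close>

definition bessel_J :: "real \<Rightarrow> real \<Rightarrow> real" where
  "bessel_J lam x =
     (\<Sum>m. (- 1) ^ m / fact m * rGamma (real m + lam + 1) * (x / 2) powr (2 * real m + lam))"

text \<open>For \<open>z = 0\<close> the formula evaluates to \<open>0\<close> rather than to the limit of the kernel; this
  affects only a null set.\<close>

definition br_kernel :: "real \<Rightarrow> real \<Rightarrow> real^'n \<Rightarrow> real" where
  "br_kernel \<alpha> R z =
     (let lam = \<alpha> + real CARD('n) / 2
      in 1 / Gamma (\<alpha> + 1) * R ^ CARD('n) * (bessel_J lam (R * norm z) / norm (R *\<^sub>R z) powr lam))"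

definition bochner_riesz ::
    "real \<Rightarrow> real \<Rightarrow> (real^'n \<Rightarrow> complex) \<Rightarrow> real^'n \<Rightarrow> complex" where
  "bochner_riesz \<alpha> R f t = (\<integral>s. f (t - s) * complex_of_real (br_kernel \<alpha> R s) \<partial>lebesgue)"

text \<open>\<^const>\<open>bochner_riesz\<close> has the value \<open>0\<close> where the integral does not converge;
  this predicate says that it converges absolutely almost everywhere.\<close>

definition bochner_riesz_defined :: "real \<Rightarrow> real \<Rightarrow> (real^'n \<Rightarrow> complex) \<Rightarrow> bool" where
  "bochner_riesz_defined \<alpha> R f \<longleftrightarrow>
     (AE t in lebesgue.
        integrable lebesgue (\<lambda>s. f (t - s) * complex_of_real (br_kernel \<alpha> R s)))"

definition q0 :: "real \<Rightarrow> nat \<Rightarrow> real" where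
  "q0 \<alpha> n = real n / ((real n + 1) / 2 + \<alpha>)"

definition p0 :: "real \<Rightarrow> nat \<Rightarrow> ereal" where
  "p0 \<alpha> n = (if q0 \<alpha> n = 1 then \<infinity> else ereal (inverse (1 - 1 / q0 \<alpha> n)))"

definition r0 :: "real \<Rightarrow> nat \<Rightarrow> real \<Rightarrow> real" where
  "r0 \<alpha> n p = p * q0 \<alpha> n / (p + q0 \<alpha> n - p * q0 \<alpha> n)"

text \<open>The solution \<open>q\<close> of \<open>1 + 1 / r = 1 / q + 1 / p\<close>.\<close>

definition q_exp :: "real \<Rightarrow> real \<Rightarrow> real" where
  "q_exp p r = p * r / (p * r + p - r)"

definition s_exp :: "real \<Rightarrow> nat \<Rightarrow> ereal \<Rightarrow> real \<Rightarrow> ereal" where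
  "s_exp \<alpha> n b r =
     min b (ereal (r * q0 \<alpha> n / (r * q0 \<alpha> n + q0 \<alpha> n - r)))"

definition d_exp :: "real \<Rightarrow> nat \<Rightarrow> ereal \<Rightarrow> ereal" where
  "d_exp \<alpha> n b =
     (if b = \<infinity> \<or> b = p0 \<alpha> n
      then Lim (at_left b) (\<lambda>b'. ereal (r0 \<alpha> n (real_of_ereal b')))
      else ereal (r0 \<alpha> n (real_of_ereal b)))"

definition nu_range :: "real \<Rightarrow> nat \<Rightarrow> ereal \<Rightarrow> real set" where
  "nu_range \<alpha> n b = {r. d_exp \<alpha> n b < ereal r \<and> 1 \<le> r}"

definition W :: "real \<Rightarrow> nat \<Rightarrow> real \<Rightarrow> real \<Rightarrow> real \<Rightarrow> real" where
  "W \<alpha> n R p r =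
     R powr (real n * (1 / p - 1 / r)) * (q_exp p r - q0 \<alpha> n) powr (1 / p - 1 - 1 / r)"

definition admissible :: "real \<Rightarrow> nat \<Rightarrow> real \<Rightarrow> real \<Rightarrow> bool" where
  "admissible \<alpha> n p r \<longleftrightarrow>
     1 < p \<and> 1 \<le> q_exp p r \<and> 1 \<le> r \<and> q0 \<alpha> n < q_exp p r \<and> ereal p \<le> p0 \<alpha> n \<and> r0 \<alpha> n p < r"

definition nu ::
    "real \<Rightarrow> nat \<Rightarrow> real \<Rightarrow> real \<Rightarrow> ereal \<Rightarrow> (real \<Rightarrow> ennreal) \<Rightarrow> real \<Rightarrow> ennreal" where
  "nu \<alpha> n R a b \<psi> r =
     (INF p \<in> {p \<in> exponents a (s_exp \<alpha> n b r). admissible \<alpha> n p r}. ennreal (W \<alpha> n R p r) * \<psi> p)"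

end

theory Submission
  imports Defs
begin

text \<open>
  The operator is a convolution with the kernel \<open>K\<close>, so everything rests on the size of
  \<open>K\<close> in \<open>L\<^sub>q\<close> and on Young's inequality
  \<open>\<parallel>f * K\<parallel>\<^sub>r \<le> \<parallel>K\<parallel>\<^sub>q \<parallel>f\<parallel>\<^sub>p\<close> for \<open>1 + 1/r = 1/q + 1/p\<close>.

  The Bessel function satisfies \<open>J\<^sub>\<lambda>(x) = O(x\<^sup>\<lambda>)\<close> near \<open>0\<close> and
  \<open>J\<^sub>\<lambda>(x) = O(x powr (-1/2))\<close> at infinity, so \<open>\<bar>K(z)\<bar>\<close> is at most a constant times
  \<open>R\<^sup>n (max 1 (R\<bar>z\<bar>)) powr (- (\<lambda> + 1/2))\<close>, where \<open>\<lambda> + 1/2 = n / q\<^sub>0\<close>.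
  This majorant is in \<open>L\<^sub>q\<close> exactly for \<open>q > q\<^sub>0\<close>. The \<open>q\<close>-th power of its norm is,
  up to a factor at most the \<open>q\<close>-th power of a constant, \<open>R powr (n (q - 1)) q / (q - q\<^sub>0)\<close>,
  and since \<open>q powr (1/q)\<close> is bounded for \<open>q \<ge> 1\<close>, one gets \<open>\<parallel>K\<parallel>\<^sub>q \<le> C R powr (n (1 - 1/q)) (q - q\<^sub>0) powr (- 1/q)\<close> with a \<open>C\<close>
  that does not depend on \<open>q\<close> (lemma \<open>br_kernel_Lq_bound\<close>). When \<open>q = q(p, r)\<close>, we have
  \<open>1 - 1/q = 1/p - 1/r\<close>, so the bound is precisely \<open>C W(p, r)\<close>.

  Young's inequality (lemma \<open>young_kernel_conv\<close>) then gives
  \<open>\<parallel>B f\<parallel>\<^sub>r \<le> C W(p, r) \<parallel>f\<parallel>\<^sub>p \<le> C W(p, r) \<psi>(p) \<parallel>f\<parallel>\<close>, the last norm being that of the Grand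
  Lebesgue Space; the infimum over the admissible \<open>p\<close> turns the weight into \<open>\<nu>(r)\<close>, and
  dividing by \<open>\<nu>(r)\<close> and taking the supremum over \<open>r\<close> ends the proof.

  The decay of \<open>J\<^sub>\<lambda>\<close> has to be extracted from its power series. The function
  \<open>u(x) = sqrt x J\<^sub>\<lambda>(x)\<close> solves \<open>u'' + (1 - k (k - 1) / x\<^sup>2) u = 0\<close> with \<open>k = \<lambda> + 1/2\<close>, which is an
  integrable perturbation of \<open>u'' + u = 0\<close>, so its energy \<open>u\<^sup>2 + u'\<^sup>2\<close> stays bounded
  (lemma \<open>bessel_series_decay_ge_1\<close>).
\<close>

section \<open>Decay of the Bessel function\<close>

definition bessel_coeff :: "real \<Rightarrow> nat \<Rightarrow> real" where
  "bessel_coeff lam m = (- 1) ^ m / fact m * rGamma (real m + lam + 1)"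

text \<open>Up to a constant factor this is \<open>J\<^sub>\<lambda>(x) / x\<^sup>\<lambda>\<close> as a function of \<open>y = (x/2)\<^sup>2\<close>. It is an
  entire function of \<open>y\<close>, so derivatives can be taken term by term, which the non-integral
  powers in \<^const>\<open>bessel_J\<close> would obstruct.\<close>

definition bessel_series :: "real \<Rightarrow> real \<Rightarrow> real" where
  "bessel_series lam y = (\<Sum>m. bessel_coeff lam m * y ^ m)"

lemma bessel_coeff_Suc_order:
  "(real m + 1) * bessel_coeff lam (Suc m) = - bessel_coeff (lam + 1) m"
proof -
  have "fact (Suc m) = (real m + 1) * fact m" by (simp add: algebra_simps)
  hence *: "(real m + 1) / fact (Suc m) = (1 / fact m :: real)" by (simp del: fact_Suc)
  have "(real m + 1) * bessel_coeff lam (Suc m)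
      = - ((real m + 1) / fact (Suc m)) * ((- 1) ^ m * rGamma (real (Suc m) + lam + 1))"
    by (simp add: bessel_coeff_def del: fact_Suc)
  also have "\<dots> = - bessel_coeff (lam + 1) m"
    unfolding * by (simp add: bessel_coeff_def add_ac)
  finally show ?thesis .
qed

lemma bessel_coeff_order:
  "bessel_coeff lam m = (real m + lam + 1) * bessel_coeff (lam + 1) m"
  using rGamma_plus1[of "real m + lam + 1"] by (simp add: bessel_coeff_def add_ac)

lemma bessel_coeff_Suc:
  "bessel_coeff lam m = - ((real m + 1) * (real m + lam + 1) * bessel_coeff lam (Suc m))"
proof -
  have *: "bessel_coeff (lam + 1) m = - ((real m + 1) * bessel_coeff lam (Suc m))"
    using bessel_coeff_Suc_order[of m lam] by simp
  show ?thesis by (subst bessel_coeff_order, subst *) (simp add: mult_ac)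
qed

lemma summable_bessel_series:
  assumes "lam > -1"
  shows "summable (\<lambda>m. bessel_coeff lam m * y ^ m)"
proof -
  obtain N where N: "real N \<ge> 2 * \<bar>y\<bar> + 1" using real_arch_simple by blast
  show ?thesis
  proof (rule summable_ratio_test[of "1/2" N])
    fix n assume "n \<ge> N"
    hence n: "real n \<ge> 2 * \<bar>y\<bar> + 1" using N by simp
    have "2 * \<bar>y\<bar> \<le> (real n + 1) * 1" using n by simp
    also have "\<dots> \<le> (real n + 1) * (real n + lam + 1)"
      using n assms by (intro mult_left_mono) linarith+
    finally have *: "2 * \<bar>y\<bar> \<le> (real n + 1) * (real n + lam + 1)" .
    have "2 * norm (bessel_coeff lam (Suc n) * y ^ Suc n)
        = 2 * \<bar>y\<bar> * (\<bar>bessel_coeff lam (Suc n)\<bar> * \<bar>y\<bar> ^ n)"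
      by (simp add: abs_mult power_abs)
    also have "\<dots> \<le> (real n + 1) * (real n + lam + 1) * (\<bar>bessel_coeff lam (Suc n)\<bar> * \<bar>y\<bar> ^ n)"
      using * by (intro mult_right_mono) auto
    also have "\<dots> = norm (bessel_coeff lam n * y ^ n)"
      using n assms by (subst (2) bessel_coeff_Suc) (simp add: abs_mult power_abs)
    finally show "norm (bessel_coeff lam (Suc n) * y ^ Suc n)
        \<le> 1 / 2 * norm (bessel_coeff lam n * y ^ n)" by simp
  qed simp
qed

lemma diffs_bessel_coeff: "diffs (bessel_coeff lam) = (\<lambda>m. - bessel_coeff (lam + 1) m)"
  using bessel_coeff_Suc_order[of _ lam] by (auto simp: diffs_def add_ac)

lemma DERIV_bessel_series:
  assumes "lam > -1"
  shows "(bessel_series lam has_real_derivative - bessel_series (lam + 1) y) (at y)"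
proof -
  have "((\<lambda>y. \<Sum>m. bessel_coeff lam m * y ^ m) has_real_derivative
          (\<Sum>m. diffs (bessel_coeff lam) m * y ^ m)) (at y)"
    by (rule termdiffs_strong_converges_everywhere) (rule summable_bessel_series[OF assms])
  moreover have "(\<Sum>m. diffs (bessel_coeff lam) m * y ^ m) = - bessel_series (lam + 1) y"
    unfolding diffs_bessel_coeff bessel_series_def
    using suminf_minus[OF summable_bessel_series[of "lam + 1" y]] assms by simp
  ultimately show ?thesis by (simp add: bessel_series_def[abs_def])
qed

text \<open>Differentiating raises the order by one, so this three-term recurrence is Bessel's
  differential equation in disguise.\<close>

lemma bessel_series_recurrence:
  assumes "lam > -1"
  shows "y * bessel_series (lam + 2) y = (lam + 1) * bessel_series (lam + 1) y - bessel_series lam y"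
proof -
  define a where "a m = (lam + 1) * (bessel_coeff (lam + 1) m * y ^ m) - bessel_coeff lam m * y ^ m" for m
  have s: "summable a" unfolding a_def
    by (intro summable_diff summable_mult summable_bessel_series) (use assms in auto)
  have "(lam + 1) * bessel_series (lam + 1) y - bessel_series lam y = suminf a"
    unfolding a_def bessel_series_def using assms
    by (subst suminf_diff[symmetric] , intro summable_mult summable_bessel_series, simp,
        intro summable_bessel_series, simp)
       (subst suminf_mult, auto intro: summable_bessel_series)
  also have "\<dots> = (\<Sum>m. a (Suc m)) + a 0" using suminf_split_head[OF s] by simp
  also have "a 0 = 0"
    using rGamma_plus1[of "lam + 1"] by (simp add: a_def bessel_coeff_def)
  also have "a (Suc m) = y * (bessel_coeff (lam + 2) m * y ^ m)" for m
  proof -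
    have 1: "bessel_coeff lam (Suc m) = (real m + lam + 2) * bessel_coeff (lam + 1) (Suc m)"
      using rGamma_plus1[of "real m + lam + 2"] by (simp add: bessel_coeff_def add_ac)
    have 2: "bessel_coeff (lam + 2) m = - (real m + 1) * bessel_coeff (lam + 1) (Suc m)"
      using fun_cong[OF diffs_bessel_coeff[of "lam + 1"], of m] by (simp add: diffs_def add_ac algebra_simps)
    show ?thesis unfolding a_def 1 2 by (simp add: algebra_simps)
  qed
  hence "(\<Sum>m. a (Suc m)) = y * bessel_series (lam + 2) y"
    unfolding bessel_series_def using assms by (simp add: suminf_mult summable_bessel_series)
  finally show ?thesis by simp
qed

lemma bessel_J_eq_series:
  assumes "lam > -1" "x > 0"
  shows "bessel_J lam x = (x / 2) powr lam * bessel_series lam ((x / 2)\<^sup>2)"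
proof -
  have "(x / 2) powr (2 * real m + lam) = (x / 2) powr lam * ((x / 2)\<^sup>2) ^ m" for m
    using assms powr_realpow[of "x / 2" "2 * m"] by (simp add: powr_add power_mult)
  hence "bessel_J lam x = (\<Sum>m. (x / 2) powr lam * (bessel_coeff lam m * ((x / 2)\<^sup>2) ^ m))"
    unfolding bessel_J_def bessel_coeff_def by (simp add: mult_ac)
  also have "\<dots> = (x / 2) powr lam * bessel_series lam ((x / 2)\<^sup>2)"
    unfolding bessel_series_def by (rule suminf_mult) (rule summable_bessel_series[OF assms(1)])
  finally show ?thesis .
qed

text \<open>With \<open>u\<close> the product of \<open>x\<^sup>k\<close> and the series, \<open>k = \<lambda> + 1/2\<close>, and \<open>v = u'\<close>, the energy
  \<open>E = u\<^sup>2 + v\<^sup>2\<close> satisfies \<open>E' = 2 k (k - 1) u v / x\<^sup>2 \<le> c E / x\<^sup>2\<close> for \<open>c = \<bar>k (k - 1)\<bar>\<close>. Hence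
  \<open>E exp(c / x)\<close> is nonincreasing, and \<open>u\<close> is bounded on \<open>[1, \<infinity>)\<close>.\<close>

lemma bessel_series_decay_ge_1:
  assumes "lam > -1"
  shows "\<exists>C. \<forall>x\<ge>1. \<bar>bessel_series lam ((x / 2)\<^sup>2)\<bar> \<le> C * x powr - (lam + 1 / 2)"
proof -
  define k where "k = lam + 1 / 2"
  define c where "c = \<bar>k * (k - 1)\<bar>"
  define S where "S j x = bessel_series (lam + j) ((x / 2)\<^sup>2)" for j x
  define u where "u x = x powr k * S 0 x" for x
  define v where "v x = k * x powr (k - 1) * S 0 x - x powr (k + 1) / 2 * S 1 x" for x
  define F where "F x = ((u x)\<^sup>2 + (v x)\<^sup>2) * exp (c / x)" for x
  have dS: "(S j has_real_derivative - (x / 2) * S (j + 1) x) (at x)" if "j \<ge> 0" for j x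
  proof -
    have "((\<lambda>x. (x / 2)\<^sup>2) has_real_derivative x / 2) (at x)"
      by (auto intro!: derivative_eq_intros)
    from DERIV_chain2[OF DERIV_bessel_series this, of "lam + j"] show ?thesis
      unfolding S_def[abs_def] using assms that by (simp add: add_ac mult_ac)
  qed
  have rec: "(x / 2)\<^sup>2 * S 2 x = (lam + 1) * S 1 x - S 0 x" for x
    using bessel_series_recurrence[OF assms] by (simp add: S_def)
  have du: "(u has_real_derivative v x) (at x)" if "x > 0" for x
  proof -
    have "(u has_real_derivative k * x powr (k - 1) * S 0 x + x powr k * (- (x / 2) * S 1 x)) (at x)"
      unfolding u_def[abs_def] using dS[of 0 x] that
      by (auto intro!: derivative_eq_intros)
    moreover have "x powr (k + 1) = x powr k * x" using that by (simp add: powr_add)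
    ultimately show ?thesis by (simp add: v_def algebra_simps)
  qed
  have dv: "(v has_real_derivative - u x + k * (k - 1) * u x / x\<^sup>2) (at x)" if "x > 0" for x
  proof -
    have "(v has_real_derivative
            k * ((k - 1) * x powr (k - 1 - 1)) * S 0 x + k * x powr (k - 1) * (- (x / 2) * S 1 x)
            - ((k + 1) * x powr k / 2 * S 1 x + x powr (k + 1) / 2 * (- (x / 2) * S 2 x))) (at x)"
      unfolding v_def[abs_def] using dS[of 0 x] dS[of 1 x] that
      by (auto intro!: derivative_eq_intros simp: field_simps)
    also have "k * ((k - 1) * x powr (k - 1 - 1)) * S 0 x + k * x powr (k - 1) * (- (x / 2) * S 1 x)
            - ((k + 1) * x powr k / 2 * S 1 x + x powr (k + 1) / 2 * (- (x / 2) * S 2 x))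
          = k * (k - 1) * u x / x\<^sup>2 - (2 * k + 1) / 2 * x powr k * S 1 x + x powr k * ((x / 2)\<^sup>2 * S 2 x)"
    proof -
      have powers: "x powr (k + 1) = x powr k * x" "x powr (k - 1) = x powr k / x"
           "x powr (k - 1 - 1) = x powr k / x\<^sup>2"
        using that by (simp_all add: powr_add powr_diff power2_eq_square)
      show ?thesis
        unfolding powers u_def using that by (simp add: field_simps power2_eq_square)
    qed
    also have "\<dots> = - u x + k * (k - 1) * u x / x\<^sup>2"
      unfolding rec by (simp add: u_def k_def algebra_simps)
    finally show ?thesis .
  qed
  (* The factor exp (c / x) contributes -c E / x^2, which absorbs the growth of E. *)
  have "F x \<le> F 1" if "x \<ge> 1" for x
  proof (rule DERIV_nonpos_imp_nonincreasing[OF that])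
    fix t :: real assume "1 \<le> t" "t \<le> x"
    hence t: "t > 0" by simp
    let ?D = "(2 * u t * v t + 2 * v t * (- u t + k * (k - 1) * u t / t\<^sup>2)) * exp (c / t)
          + ((u t)\<^sup>2 + (v t)\<^sup>2) * (exp (c / t) * (- c / t\<^sup>2))"
    have "(F has_real_derivative ?D) (at t)"
      unfolding F_def[abs_def] using du[OF t] dv[OF t] t
      by (auto intro!: derivative_eq_intros simp: power2_eq_square) (simp add: field_simps)
    moreover have "?D = exp (c / t) / t\<^sup>2 * (k * (k - 1) * (2 * u t * v t) - c * ((u t)\<^sup>2 + (v t)\<^sup>2))"
      using t by (simp add: field_simps)
    moreover have "k * (k - 1) * (2 * u t * v t) \<le> c * ((u t)\<^sup>2 + (v t)\<^sup>2)"
    proof -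
      have "k * (k - 1) * (2 * u t * v t) \<le> \<bar>k * (k - 1) * (2 * u t * v t)\<bar>" by simp
      also have "\<dots> = c * (2 * \<bar>u t\<bar> * \<bar>v t\<bar>)" by (simp add: c_def abs_mult)
      also have "\<dots> \<le> c * ((u t)\<^sup>2 + (v t)\<^sup>2)"
        using sum_squares_bound[of "\<bar>u t\<bar>" "\<bar>v t\<bar>"] by (intro mult_left_mono) (auto simp: c_def)
      finally show ?thesis .
    qed
    ultimately show "\<exists>y. (F has_real_derivative y) (at t) \<and> y \<le> 0"
      by (metis diff_le_0_iff_le exp_ge_zero mult_nonneg_nonpos zero_le_divide_iff zero_le_power2)
  qed
  hence Fb: "F x \<le> F 1" if "x \<ge> 1" for x using that by blast
  show ?thesis
  proof (intro exI allI impI)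
    fix x :: real assume x: "x \<ge> 1"
    have "(u x)\<^sup>2 * 1 \<le> F x"
      unfolding F_def using x by (intro mult_mono) (auto simp: c_def)
    also note Fb[OF x]
    finally have "(u x)\<^sup>2 \<le> F 1" by simp
    hence "\<bar>u x\<bar> \<le> sqrt (F 1)" using real_le_rsqrt by fastforce
    moreover have "\<bar>u x\<bar> = x powr k * \<bar>bessel_series lam ((x / 2)\<^sup>2)\<bar>"
      by (simp add: u_def S_def abs_mult)
    ultimately show "\<bar>bessel_series lam ((x / 2)\<^sup>2)\<bar> \<le> sqrt (F 1) * x powr - (lam + 1 / 2)"
      using x by (simp add: k_def powr_minus field_simps)
  qed
qed

lemma continuous_bessel_series:
  assumes "lam > -1"
  shows "continuous_on UNIV (bessel_series lam)"
  by (rule DERIV_continuous_on) (rule DERIV_bessel_series[OF assms, THEN DERIV_subset, OF subset_UNIV])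

text \<open>On \<open>[0, 1]\<close> the series is bounded by continuity; the truncation \<open>max 1 x\<close> joins both
  regimes in one majorant.\<close>

lemma bessel_series_decay:
  assumes "lam > -1"
  shows "\<exists>C>0. \<forall>x\<ge>0. \<bar>bessel_series lam ((x / 2)\<^sup>2)\<bar> \<le> C * (max 1 x) powr - (lam + 1 / 2)"
proof -
  obtain C1 where C1: "\<And>x. x \<ge> 1 \<Longrightarrow> \<bar>bessel_series lam ((x / 2)\<^sup>2)\<bar> \<le> C1 * x powr - (lam + 1 / 2)"
    using bessel_series_decay_ge_1[OF assms] by blast
  have "continuous_on {0..1} (\<lambda>x. bessel_series lam ((x / 2)\<^sup>2))"
    by (intro continuous_on_compose2[OF continuous_bessel_series[OF assms]] continuous_intros) simp_all
  hence "bounded ((\<lambda>x. bessel_series lam ((x / 2)\<^sup>2)) ` {0..1})"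
    by (intro compact_imp_bounded compact_continuous_image compact_Icc)
  then obtain C2 where C2: "C2 > 0" "\<And>x. x \<in> {0..1} \<Longrightarrow> \<bar>bessel_series lam ((x / 2)\<^sup>2)\<bar> \<le> C2"
    unfolding bounded_pos ball_simps real_norm_def by blast
  have "\<bar>bessel_series lam ((x / 2)\<^sup>2)\<bar> \<le> max C1 C2 * (max 1 x) powr - (lam + 1 / 2)" if "x \<ge> 0" for x
  proof (cases "x \<ge> 1")
    case True
    have "\<bar>bessel_series lam ((x / 2)\<^sup>2)\<bar> \<le> C1 * x powr - (lam + 1 / 2)" by (rule C1[OF True])
    also have "\<dots> \<le> max C1 C2 * x powr - (lam + 1 / 2)" by (intro mult_right_mono) auto
    finally show ?thesis using True by (simp add: max_def)
  next
    case False
    thus ?thesis using C2(2)[of x] that by (simp add: max_def)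
  qed
  thus ?thesis using C2(1) by (intro exI[of _ "max C1 C2"]) auto
qed

section \<open>Size of the Bochner-Riesz kernel\<close>

text \<open>Layer-cake formula: for \<open>0 < t \<le> 1\<close> the set where the integrand is at least \<open>t\<close> is a ball
  of radius \<open>t powr (- 1/\<beta>) / R\<close>, and integrating its volume over \<open>t\<close> leaves an integral of a
  power of \<open>t\<close> with exponent \<open>- n / \<beta> > - 1\<close>.\<close>

lemma nn_integral_radial_tail:
  fixes \<beta> R :: real
  assumes R: "R > 0" and \<beta>: "\<beta> > real DIM('a::euclidean_space)"
  shows "(\<integral>\<^sup>+ s. ennreal ((max 1 (R * norm (s::'a))) powr - \<beta>) \<partial>lborel)
    = ennreal (unit_ball_vol (real DIM('a)) / R ^ DIM('a) * (\<beta> / (\<beta> - real DIM('a))))"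
proof -
  let ?n = "DIM('a)"
  define \<phi> where "\<phi> s = (max 1 (R * norm (s::'a))) powr - \<beta>" for s
  have [measurable]: "\<phi> \<in> borel_measurable borel" unfolding \<phi>_def by measurable
  have \<beta>0: "\<beta> > 0" using \<beta> by (meson le_less_trans of_nat_0_le_iff)
  have \<phi>_pos: "\<phi> s > 0" for s unfolding \<phi>_def by auto
  have superlevel: "t \<le> \<phi> s \<longleftrightarrow> t \<le> 1 \<and> s \<in> cball 0 (t powr - (1 / \<beta>) / R)" if t: "t > 0" for s t
  proof -
    have "t \<le> \<phi> s \<longleftrightarrow> max 1 (R * norm s) \<le> t powr - (1 / \<beta>)"
    proof
      assume "t \<le> \<phi> s"
      hence "\<phi> s powr - (1 / \<beta>) \<le> t powr - (1 / \<beta>)" using \<beta>0 t by (intro powr_mono2') auto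
      thus "max 1 (R * norm s) \<le> t powr - (1 / \<beta>)" using \<beta>0 by (simp add: \<phi>_def powr_powr)
    next
      assume "max 1 (R * norm s) \<le> t powr - (1 / \<beta>)"
      hence "(t powr - (1 / \<beta>)) powr - \<beta> \<le> \<phi> s" unfolding \<phi>_def using \<beta>0 by (intro powr_mono2') auto
      thus "t \<le> \<phi> s" using \<beta>0 t by (simp add: powr_powr)
    qed
    moreover have "1 \<le> t powr - (1 / \<beta>) \<longleftrightarrow> t \<le> 1"
    proof
      assume "t \<le> 1"
      thus "1 \<le> t powr - (1 / \<beta>)" using powr_mono2'[of "- (1 / \<beta>)" t 1] \<beta>0 t by simp
    next
      assume "1 \<le> t powr - (1 / \<beta>)"
      hence "(t powr - (1 / \<beta>)) powr - \<beta> \<le> 1 powr - \<beta>" using \<beta>0 by (intro powr_mono2') auto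
      thus "t \<le> 1" using \<beta>0 t by (simp add: powr_powr)
    qed
    ultimately show ?thesis using R by (simp add: pos_le_divide_eq mult.commute)
  qed
  have "(\<integral>\<^sup>+ s. ennreal (\<phi> s) \<partial>lborel) = (\<integral>\<^sup>+ s. (\<integral>\<^sup>+ t. indicator {0<..\<phi> s} t \<partial>lborel) \<partial>lborel)"
    using \<phi>_pos by (intro nn_integral_cong) (simp add: less_imp_le)
  also have "\<dots> = (\<integral>\<^sup>+ t. (\<integral>\<^sup>+ s. indicator {0<..\<phi> s} t \<partial>lborel) \<partial>lborel)"
  proof (rule lborel_pair.Fubini')
    have "(\<lambda>(t, s). indicator {0<..\<phi> s} t :: ennreal) = indicator {x. 0 < fst x \<and> fst x \<le> \<phi> (snd x)}"
      by (auto simp: fun_eq_iff indicator_def)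
    thus "(\<lambda>(t, s). indicator {0<..\<phi> s} t :: ennreal) \<in> borel_measurable (lborel \<Otimes>\<^sub>M lborel)"
      by simp
  qed
  also have "\<dots> = (\<integral>\<^sup>+ t. ennreal (unit_ball_vol (real ?n) / R ^ ?n) *
                   (ennreal (t powr - (real ?n / \<beta>)) * indicator {0..1} t) \<partial>lborel)"
  proof (rule nn_integral_cong_AE, use AE_lborel_singleton[of 0] in eventually_elim)
    fix t :: real assume "t \<noteq> 0"
    show "(\<integral>\<^sup>+ s. indicator {0<..\<phi> s} t \<partial>lborel)
        = ennreal (unit_ball_vol (real ?n) / R ^ ?n) * (ennreal (t powr - (real ?n / \<beta>)) * indicator {0..1} t)"
    proof (cases "0 < t \<and> t \<le> 1")
      case False
      hence "indicator {0<..\<phi> s} t = (0::ennreal)" for s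
        using superlevel[of t s] by (auto simp: indicator_def)
      thus ?thesis using False \<open>t \<noteq> 0\<close> by (auto simp: indicator_def)
    next
      case True
      hence "(\<integral>\<^sup>+ s. indicator {0<..\<phi> s} t \<partial>lborel)
          = (\<integral>\<^sup>+ s. indicator (cball (0::'a) (t powr - (1 / \<beta>) / R)) s \<partial>lborel)"
        using superlevel[of t] by (intro nn_integral_cong) (auto simp: indicator_def)
      also have "\<dots> = ennreal (unit_ball_vol (real ?n) * (t powr - (1 / \<beta>) / R) ^ ?n)"
        using R by (simp add: emeasure_cball)
      also have "(t powr - (1 / \<beta>) / R) ^ ?n = t powr - (real ?n / \<beta>) / R ^ ?n"
        using True by (simp add: power_divide powr_realpow[symmetric] powr_powr)
      finally show ?thesis using True R by (simp add: ennreal_mult[symmetric])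
    qed
  qed
  also have "\<dots> = ennreal (unit_ball_vol (real ?n) / R ^ ?n) *
                   (\<integral>\<^sup>+ t. ennreal (t powr - (real ?n / \<beta>)) * indicator {0..1} t \<partial>lborel)"
    by (rule nn_integral_cmult) measurable
  also have "(\<integral>\<^sup>+ t. ennreal (t powr - (real ?n / \<beta>)) * indicator {0..1} t \<partial>lborel)
      = ennreal (1 powr (- (real ?n / \<beta>) + 1) / (- (real ?n / \<beta>) + 1))"
    by (intro nn_integral_has_integral_lebesgue' has_integral_powr_from_0) (use \<beta> \<beta>0 in auto)
  also have "1 powr (- (real ?n / \<beta>) + 1) / (- (real ?n / \<beta>) + 1) = \<beta> / (\<beta> - real ?n)"
    using \<beta> \<beta>0 by (simp add: field_simps)
  also have "ennreal (unit_ball_vol (real ?n) / R ^ ?n) * ennreal (\<beta> / (\<beta> - real ?n))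
      = ennreal (unit_ball_vol (real ?n) / R ^ ?n * (\<beta> / (\<beta> - real ?n)))"
    using R \<beta> \<beta>0 by (simp add: ennreal_mult[symmetric])
  finally show ?thesis by (simp add: \<phi>_def)
qed

lemma br_kernel_eq:
  fixes z :: "real^'n"
  assumes "\<alpha> > -1" "R > 0" "z \<noteq> 0"
  shows "br_kernel \<alpha> R z = R ^ CARD('n) * (2 powr - (\<alpha> + real CARD('n) / 2) / Gamma (\<alpha> + 1)
           * bessel_series (\<alpha> + real CARD('n) / 2) ((R * norm z / 2)\<^sup>2))"
proof -
  define lam where "lam = \<alpha> + real CARD('n) / 2"
  have x: "R * norm z > 0" using assms by simp
  have "lam > -1" using assms unfolding lam_def by (simp add: add_strict_increasing)
  hence "bessel_J lam (R * norm z) / (R * norm z) powr lam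
      = 2 powr - lam * bessel_series lam ((R * norm z / 2)\<^sup>2)"
    using x assms by (simp add: bessel_J_eq_series powr_divide powr_minus field_simps)
  thus ?thesis
    using assms unfolding br_kernel_def Let_def lam_def[symmetric] by (simp add: mult_ac)
qed

lemma br_kernel_0: "br_kernel \<alpha> R (0::real^'n) = 0"
  by (simp add: br_kernel_def)

lemma borel_measurable_br_kernel:
  assumes "\<alpha> > -1" "R > 0"
  shows "(br_kernel \<alpha> R :: real^'n \<Rightarrow> real) \<in> borel_measurable borel"
proof -
  define lam where "lam = \<alpha> + real CARD('n) / 2"
  have "lam > -1" using assms unfolding lam_def by (simp add: add_strict_increasing)
  hence [measurable]: "bessel_series lam \<in> borel_measurable borel"
    by (intro borel_measurable_continuous_onI continuous_bessel_series)
  have "br_kernel \<alpha> R = (\<lambda>z::real^'n. if z = 0 then 0 else R ^ CARD('n) * (2 powr - lam / Gamma (\<alpha> + 1)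
           * bessel_series lam ((R * norm z / 2)\<^sup>2)))"
    using br_kernel_eq[OF assms, where 'n='n] br_kernel_0[of \<alpha> R, where 'n='n] unfolding lam_def by auto
  also have "\<dots> \<in> borel_measurable borel" by measurable
  finally show ?thesis .
qed

text \<open>Here \<open>n / q\<^sub>0 = \<alpha> + (n + 1) / 2 = \<lambda> + 1/2\<close> is the decay exponent of \<open>J\<^sub>\<lambda>(x) / x\<^sup>\<lambda>\<close>.\<close>

lemma br_kernel_bound:
  assumes "\<alpha> > -1" "R > 0" 
  shows "\<exists>C>0. \<forall>z::real^'n. \<bar>br_kernel \<alpha> R z\<bar>
           \<le> C * R ^ CARD('n) * (max 1 (R * norm z)) powr - (real CARD('n) / q0 \<alpha> CARD('n))"
proof -
  define lam where "lam = \<alpha> + real CARD('n) / 2"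
  have "lam > -1" using assms unfolding lam_def by (simp add: add_strict_increasing)
  from bessel_series_decay[OF this] obtain C where C: "C > 0"
    "\<And>x. x \<ge> 0 \<Longrightarrow> \<bar>bessel_series lam ((x / 2)\<^sup>2)\<bar> \<le> C * (max 1 x) powr - (lam + 1 / 2)" by blast
  have e: "real CARD('n) / q0 \<alpha> CARD('n) = lam + 1 / 2"
    using assms by (simp add: q0_def lam_def field_simps)
  define D where "D = 2 powr - lam / Gamma (\<alpha> + 1)"
  have D: "D > 0" using assms by (simp add: D_def Gamma_real_pos)
  have "\<bar>br_kernel \<alpha> R z\<bar> \<le> D * C * R ^ CARD('n) * (max 1 (R * norm z)) powr - (lam + 1 / 2)" for z :: "real^'n"
  proof (cases "z = 0")
    case True
    thus ?thesis using C D assms by (simp add: br_kernel_0)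
  next
    case False
    have "\<bar>br_kernel \<alpha> R z\<bar> = R ^ CARD('n) * (D * \<bar>bessel_series lam ((R * norm z / 2)\<^sup>2)\<bar>)"
      using br_kernel_eq[OF assms False] D assms
      unfolding lam_def[symmetric] D_def[symmetric] by (simp add: abs_mult)
    also have "\<dots> \<le> R ^ CARD('n) * (D * (C * (max 1 (R * norm z)) powr - (lam + 1 / 2)))"
      using assms D by (intro mult_left_mono C(2)) auto
    finally show ?thesis by (simp add: mult_ac)
  qed
  thus ?thesis unfolding e using C D by (intro exI[of _ "D * C"]) auto
qed

text \<open>The point is that \<open>C\<close> is uniform in \<open>q\<close>, up to the blow-up at \<open>q\<^sub>0\<close> which is explicit. The
  integral of the majorant carries the factors \<open>V\<close> (volume of the unit ball) and \<open>q\<close>, and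
  \<open>V q \<le> (max 1 V \<cdot> e)\<^sup>q\<close> because \<open>q \<ge> 1\<close> and \<open>q \<le> e\<^sup>q\<close>.\<close>

lemma br_kernel_Lq_bound:
  assumes "\<alpha> > -1" "R > 0" 
  shows "\<exists>C>0. \<forall>q. q \<ge> 1 \<longrightarrow> q > q0 \<alpha> CARD('n) \<longrightarrow>
     (\<integral>\<^sup>+ (z::real^'n). ennreal (\<bar>br_kernel \<alpha> R z\<bar> powr q) \<partial>lborel)
       \<le> ennreal ((C * R powr (real CARD('n) * (1 - 1 / q)) * (q - q0 \<alpha> CARD('n)) powr - (1 / q)) powr q)"
proof -
  let ?n = "CARD('n)"
  define Q where "Q = q0 \<alpha> ?n"
  have Q: "Q > 0"
  proof -
    have "N / ((N + 1) / 2 + \<alpha>) > 0" if "N \<ge> 1" for N :: real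
      using that assms(1) by (intro divide_pos_pos) (simp_all add: field_simps)
    moreover have "real ?n \<ge> 1" by (simp add: Suc_leI)
    ultimately show ?thesis unfolding Q_def q0_def by blast
  qed
  define V where "V = unit_ball_vol (real ?n)"
  have V: "V \<ge> 0" by (simp add: V_def)
  obtain C0 where C0: "C0 > 0"
    "\<And>z::real^'n. \<bar>br_kernel \<alpha> R z\<bar> \<le> C0 * R ^ ?n * (max 1 (R * norm z)) powr - (real ?n / Q)"
    using br_kernel_bound[OF assms, where 'n='n] unfolding Q_def by blast
  define C where "C = C0 * max 1 V * exp 1"
  show ?thesis
  proof (intro exI[of _ C] conjI allI impI)
    show "C > 0" using C0 by (simp add: C_def)
    fix q assume q: "q \<ge> 1" "q > q0 \<alpha> ?n"
    hence qQ: "q > Q" by (simp add: Q_def)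
    have "(\<integral>\<^sup>+ (z::real^'n). ennreal (\<bar>br_kernel \<alpha> R z\<bar> powr q) \<partial>lborel)
        \<le> (\<integral>\<^sup>+ (z::real^'n). ennreal ((C0 * R ^ ?n) powr q) *
              ennreal ((max 1 (R * norm z)) powr - (real ?n * q / Q)) \<partial>lborel)"
    proof (rule nn_integral_mono)
      fix z :: "real^'n"
      have "\<bar>br_kernel \<alpha> R z\<bar> powr q \<le> (C0 * R ^ ?n * (max 1 (R * norm z)) powr - (real ?n / Q)) powr q"
        using q C0 by (intro powr_mono2) auto
      also have "\<dots> = (C0 * R ^ ?n) powr q * (max 1 (R * norm z)) powr - (real ?n * q / Q)"
        using C0 assms by (simp add: powr_mult powr_powr)
      finally show "ennreal (\<bar>br_kernel \<alpha> R z\<bar> powr q) \<le> ennreal ((C0 * R ^ ?n) powr q) *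
              ennreal ((max 1 (R * norm z)) powr - (real ?n * q / Q))"
        by (simp add: ennreal_mult[symmetric] ennreal_leI)
    qed
    also have "\<dots> = ennreal ((C0 * R ^ ?n) powr q) *
        (\<integral>\<^sup>+ (z::real^'n). ennreal ((max 1 (R * norm z)) powr - (real ?n * q / Q)) \<partial>lborel)"
      by (rule nn_integral_cmult) measurable
    also have "(\<integral>\<^sup>+ (z::real^'n). ennreal ((max 1 (R * norm z)) powr - (real ?n * q / Q)) \<partial>lborel)
        = ennreal (V / R ^ ?n * (q / (q - Q)))"
    proof -
      define b where "b = real ?n * q / Q"
      have b: "b > real ?n" using qQ Q by (simp add: b_def field_simps)
      have "b / (b - real ?n) = q / (q - Q)"
        using qQ Q by (simp add: b_def divide_simps) (simp add: algebra_simps)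
      moreover have "(\<integral>\<^sup>+ (z::real^'n). ennreal ((max 1 (R * norm z)) powr - b) \<partial>lborel)
          = ennreal (V / R ^ ?n * (b / (b - real ?n)))"
        using nn_integral_radial_tail[where 'a="real^'n", OF assms(2), of b] b by (simp add: V_def)
      ultimately show ?thesis by (simp add: b_def)
    qed
    also have "ennreal ((C0 * R ^ ?n) powr q) * \<dots>
        = ennreal ((C0 * R ^ ?n) powr q * (V / R ^ ?n * (q / (q - Q))))"
      using assms qQ q V by (simp add: ennreal_mult[symmetric])
    also have "\<dots> \<le> ennreal ((C * R powr (real ?n * (1 - 1 / q)) * (q - Q) powr - (1 / q)) powr q)"
    proof (rule ennreal_leI)
      have Vq: "V * q \<le> (max 1 V) powr q * exp 1 powr q"
      proof (rule mult_mono)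
        show "V \<le> max 1 V powr q" using powr_mono[of 1 q "max 1 V"] q by (simp add: powr_one)
        have "q \<le> exp q" using exp_ge_add_one_self[of q] by linarith
        thus "q \<le> exp 1 powr q" by (simp add: powr_def)
      qed (use q V in auto)

      have Rq: "(R ^ ?n) powr q / R ^ ?n = (R powr (real ?n * (1 - 1 / q))) powr q"
        using assms q by (simp add: powr_realpow[symmetric] powr_powr powr_diff[symmetric] algebra_simps)
      have Qq: "((q - Q) powr - (1 / q)) powr q = 1 / (q - Q)"
      proof -
        have "((q - Q) powr - (1 / q)) powr q = (q - Q) powr - 1" using q by (simp add: powr_powr)
        also have "\<dots> = 1 / (q - Q)" using qQ by (simp add: powr_minus_divide)
        finally show ?thesis .
      qed
      have "(C0 * R ^ ?n) powr q * (V / R ^ ?n * (q / (q - Q)))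
          = C0 powr q * (V * q) * ((R ^ ?n) powr q / R ^ ?n * (1 / (q - Q)))"
        using assms C0 by (simp add: powr_mult)
      also have "\<dots> \<le> C0 powr q * ((max 1 V) powr q * exp 1 powr q) * ((R ^ ?n) powr q / R ^ ?n * (1 / (q - Q)))"
        using Vq assms qQ by (intro mult_right_mono mult_left_mono) auto
      also have "\<dots> = (C * R powr (real ?n * (1 - 1 / q)) * (q - Q) powr - (1 / q)) powr q"
        using C0 unfolding Rq Qq[symmetric] C_def by (simp add: powr_mult)
      finally show "(C0 * R ^ ?n) powr q * (V / R ^ ?n * (q / (q - Q)))
         \<le> (C * R powr (real ?n * (1 - 1 / q)) * (q - Q) powr - (1 / q)) powr q" .
    qed
    finally show "(\<integral>\<^sup>+ (z::real^'n). ennreal (\<bar>br_kernel \<alpha> R z\<bar> powr q) \<partial>lborel)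
       \<le> ennreal ((C * R powr (real ?n * (1 - 1 / q)) * (q - q0 \<alpha> ?n) powr - (1 / q)) powr q)"
      by (simp add: Q_def)
  qed
qed

section \<open>Young's inequality for convolutions\<close>

lemma lborel_distr_reflect:
  fixes t :: "'a::euclidean_space"
  shows "distr lborel borel ((-) t) = lborel"
  by (subst lborel_affine[of "-1" t]) (auto simp: density_1)

lemma nn_integral_lborel_reflect:
  fixes t :: "'a::euclidean_space"
  assumes [measurable]: "g \<in> borel_measurable borel"
  shows "(\<integral>\<^sup>+ s. g (t - s) \<partial>lborel) = (\<integral>\<^sup>+ s. g s \<partial>lborel)"
  by (subst (2) lborel_distr_reflect[of t, symmetric]) (simp add: nn_integral_distr)

lemma nn_integral_lborel_translate:
  fixes s :: "'a::euclidean_space"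
  assumes [measurable]: "g \<in> borel_measurable borel"
  shows "(\<integral>\<^sup>+ t. g (t - s) \<partial>lborel) = (\<integral>\<^sup>+ t. g t \<partial>lborel)"
  by (subst (2) lborel_distr_plus[of "- s", symmetric]) (simp add: nn_integral_distr)

lemma AE_lborel_reflect:
  fixes t :: "'a::euclidean_space"
  assumes "AE s in lborel. P s"
  shows "AE s in lborel. P (t - s)"
proof -
  have "AE s in distr lborel borel ((-) t). P s"
    unfolding lborel_distr_reflect by (rule assms)
  thus ?thesis by (rule AE_distrD[rotated]) simp
qed

text \<open>Divide by the geometric mean \<open>G\<close> and add up \<open>1 + ln (x / G) \<le> x / G\<close> with the weights: the
  logarithms cancel.\<close>

lemma weighted_arith_geom_mean3:
  fixes a b c x y z :: real
  assumes "a \<ge> 0" "b \<ge> 0" "c \<ge> 0" "a + b + c = 1" "x > 0" "y > 0" "z > 0"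
  shows "x powr a * y powr b * z powr c \<le> a * x + b * y + c * z"
proof -
  define G where "G = x powr a * y powr b * z powr c"
  have G: "G > 0" using assms by (simp add: G_def)
  have lnG: "ln G = a * ln x + b * ln y + c * ln z"
    using assms by (simp add: G_def ln_mult ln_powr)
  have l: "1 + ln t - ln G \<le> t / G" if "t > 0" for t
    using ln_le_minus_one[of "t / G"] that G by (simp add: ln_div)
  have "1 = a * (1 + ln x - ln G) + b * (1 + ln y - ln G) + c * (1 + ln z - ln G)"
  proof -
    have "a * (1 + ln x - ln G) + b * (1 + ln y - ln G) + c * (1 + ln z - ln G)
        = (a + b + c) + ln G - (a + b + c) * ln G"
      unfolding lnG by (simp add: algebra_simps)
    thus ?thesis using assms by simp
  qed
  also have "\<dots> \<le> a * (x / G) + b * (y / G) + c * (z / G)"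
    using assms l by (intro add_mono mult_left_mono) auto
  also have "\<dots> = (a * x + b * y + c * z) / G" by (simp add: add_divide_distrib)
  finally show ?thesis using G unfolding G_def[symmetric] by (simp add: field_simps)
qed

text \<open>These are the weights of the arithmetic-geometric mean inequality below; the scaling
  relation says that they add up to \<open>1\<close> with \<open>1/r\<close>.\<close>

lemma young_weights_nonneg:
  fixes p q r :: real
  assumes "p \<ge> 1" "q \<ge> 1" "r \<ge> 1" "1 + 1 / r = 1 / q + 1 / p"
  shows "0 \<le> 1 / p - 1 / r" "0 \<le> 1 / q - 1 / r" "0 \<le> 1 / r"
proof -
  have "1 / q \<le> 1" "1 / p \<le> 1" "0 \<le> 1 / r" using assms by simp_all
  thus "0 \<le> 1 / p - 1 / r" "0 \<le> 1 / q - 1 / r" "0 \<le> 1 / r" using assms by linarith+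
qed

text \<open>The usual three-factor Hoelder argument writes
  \<open>x y = (x\<^sup>p y\<^sup>q) powr (1/r) \<cdot> (x\<^sup>p) powr (1/p - 1/r) \<cdot> (y\<^sup>q) powr (1/q - 1/r)\<close>. The weighted
  arithmetic-geometric mean inequality linearises this product before integration; \<open>M\<close> will be
  the integral of \<open>x\<^sup>p y\<^sup>q\<close>, which for normalised factors makes the right-hand side integrate to at
  most \<open>M powr (1/r)\<close>.\<close>

lemma young_pointwise:
  fixes x y M p q r :: real
  assumes pqr: "p \<ge> 1" "q \<ge> 1" "r \<ge> 1" "1 + 1 / r = 1 / q + 1 / p"
    and nn: "x \<ge> 0" "y \<ge> 0" "M > 0"
  shows "x * y \<le> M powr (1 / r) *
           (x powr p * y powr q / M / r + (1 / p - 1 / r) * x powr p + (1 / q - 1 / r) * y powr q)"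
proof -
  have w: "0 \<le> 1 / p - 1 / r" "0 \<le> 1 / q - 1 / r" "0 \<le> 1 / r"
    by (rule young_weights_nonneg[OF pqr])+
  show ?thesis
  proof (cases "x = 0 \<or> y = 0")
    case True
    thus ?thesis using w nn by (auto intro!: mult_nonneg_nonneg)
  next
    case False
    hence xy: "x > 0" "y > 0" using nn by auto
    have "x * y = M powr (1 / r) * ((x powr p * y powr q / M) powr (1 / r)
            * (x powr p) powr (1 / p - 1 / r) * (y powr q) powr (1 / q - 1 / r))"
    proof -
      let ?X1 = "(x powr p) powr (1 / r)" and ?X2 = "(x powr p) powr (1 / p - 1 / r)"
      let ?Y1 = "(y powr q) powr (1 / r)" and ?Y2 = "(y powr q) powr (1 / q - 1 / r)"
      let ?T = "(x powr p * y powr q / M) powr (1 / r)"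
      have X: "?X1 * ?X2 = x" and Y: "?Y1 * ?Y2 = y"
        using xy pqr by (simp_all add: powr_powr powr_add[symmetric] field_simps)
      have T: "M powr (1 / r) * ?T = ?X1 * ?Y1"
        using xy nn by (simp add: powr_mult powr_divide)
      have "x * y = (?X1 * ?X2) * (?Y1 * ?Y2)" by (simp only: X Y)
      also have "\<dots> = (?X1 * ?Y1) * ?X2 * ?Y2" by (simp only: mult_ac)
      also have "\<dots> = M powr (1 / r) * (?T * ?X2 * ?Y2)" by (simp only: T[symmetric] mult.assoc)
      finally show ?thesis .
    qed
    also have "\<dots> \<le> M powr (1 / r) * (1 / r * (x powr p * y powr q / M)
            + (1 / p - 1 / r) * (x powr p) + (1 / q - 1 / r) * (y powr q))"
      using xy nn w pqr by (intro mult_left_mono weighted_arith_geom_mean3) auto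
    finally show ?thesis by (simp add: mult.commute)
  qed
qed

text \<open>Put \<open>m = f\<^sup>p * k\<^sup>q\<close>. Integrating the pointwise inequality with \<open>M = m(t)\<close> gives \<open>h\<^sup>r \<le> m\<close>
  wherever \<open>m\<close> is finite, and Tonelli's theorem gives \<open>\<integral>m \<le> 1\<close>.\<close>

lemma young_normalised:
  fixes f k :: "'a::euclidean_space \<Rightarrow> real" and p q r :: real
  assumes [measurable]: "f \<in> borel_measurable borel" "k \<in> borel_measurable borel"
    and nn: "\<And>x. f x \<ge> 0" "\<And>x. k x \<ge> 0"
    and pqr: "p \<ge> 1" "q \<ge> 1" "r \<ge> 1" "1 + 1 / r = 1 / q + 1 / p"
    and f1: "(\<integral>\<^sup>+ x. ennreal (f x powr p) \<partial>lborel) \<le> 1"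
    and k1: "(\<integral>\<^sup>+ x. ennreal (k x powr q) \<partial>lborel) \<le> 1"
  defines "h \<equiv> \<lambda>t. \<integral>\<^sup>+ s. ennreal (f (t - s) * k s) \<partial>lborel"
  shows "AE t in lborel. h t < \<infinity>"
    and "(\<integral>\<^sup>+ t. ennreal (enn2real (h t) powr r) \<partial>lborel) \<le> 1"
proof -
  define m where "m t = (\<integral>\<^sup>+ s. ennreal (f (t - s) powr p * k s powr q) \<partial>lborel)" for t
  have [measurable]: "m \<in> borel_measurable borel" unfolding m_def by measurable
  have w: "0 \<le> 1 / p - 1 / r" "0 \<le> 1 / q - 1 / r" "0 \<le> 1 / r"
    by (rule young_weights_nonneg[OF pqr])+
  have int_m: "(\<integral>\<^sup>+ t. m t \<partial>lborel) \<le> 1"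
  proof -
    have "(\<integral>\<^sup>+ t. m t \<partial>lborel)
        = (\<integral>\<^sup>+ s. (\<integral>\<^sup>+ t. ennreal (f (t - s) powr p * k s powr q) \<partial>lborel) \<partial>lborel)"
      unfolding m_def by (rule lborel_pair.Fubini') measurable
    also have "\<dots> = (\<integral>\<^sup>+ s. (\<integral>\<^sup>+ t. ennreal (f t powr p) \<partial>lborel) * ennreal (k s powr q) \<partial>lborel)"
    proof (rule nn_integral_cong)
      fix s
      have "(\<integral>\<^sup>+ t. ennreal (f (t - s) powr p * k s powr q) \<partial>lborel)
          = (\<integral>\<^sup>+ t. ennreal (f (t - s) powr p) * ennreal (k s powr q) \<partial>lborel)"
        by (simp add: ennreal_mult)
      also have "\<dots> = (\<integral>\<^sup>+ t. ennreal (f (t - s) powr p) \<partial>lborel) * ennreal (k s powr q)"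
        by (rule nn_integral_multc) measurable
      also have "(\<integral>\<^sup>+ t. ennreal (f (t - s) powr p) \<partial>lborel) = (\<integral>\<^sup>+ t. ennreal (f t powr p) \<partial>lborel)"
        by (rule nn_integral_lborel_translate[of "\<lambda>t. ennreal (f t powr p)"]) measurable
      finally show "(\<integral>\<^sup>+ t. ennreal (f (t - s) powr p * k s powr q) \<partial>lborel)
          = (\<integral>\<^sup>+ t. ennreal (f t powr p) \<partial>lborel) * ennreal (k s powr q)" .
    qed
    also have "\<dots> = (\<integral>\<^sup>+ t. ennreal (f t powr p) \<partial>lborel) * (\<integral>\<^sup>+ s. ennreal (k s powr q) \<partial>lborel)"
      by (rule nn_integral_cmult) measurable
    also have "\<dots> \<le> 1 * 1" using f1 k1 by (rule mult_mono) auto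
    finally show ?thesis by simp
  qed
  have fin: "AE t in lborel. m t \<noteq> \<infinity>"
    by (rule nn_integral_noteq_infinite) (use int_m in \<open>auto simp: top_unique\<close>)
  have h_le: "h t \<le> ennreal (enn2real (m t) powr (1 / r))" if "m t \<noteq> \<infinity>" for t
  proof (cases "m t = 0")
    (* The pointwise inequality needs M > 0; if m t = 0, the integrand of h t vanishes almost everywhere. *)
    case True
    have "AE s in lborel. ennreal (f (t - s) powr p * k s powr q) = 0"
      using True unfolding m_def by (subst (asm) nn_integral_0_iff_AE) auto
    hence "AE s in lborel. ennreal (f (t - s) * k s) = 0"
    proof eventually_elim
      case (elim s)
      hence "f (t - s) powr p * k s powr q = 0" using mult_nonneg_nonneg[OF powr_ge_zero[of "f (t - s)" p] powr_ge_zero[of "k s" q]]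
        by (simp add: ennreal_eq_0_iff del: mult_eq_0_iff)
      thus ?case by auto
    qed
    hence "h t = 0" unfolding h_def by (subst nn_integral_0_iff_AE) auto
    thus ?thesis by simp
  next
    case False
    define M where "M = enn2real (m t)"
    have mM: "m t = ennreal M" using that by (simp add: M_def ennreal_enn2real_if)
    have M: "M > 0" using False mM by (metis M_def enn2real_nonneg ennreal_0 less_eq_real_def)
    let ?c = "M powr (1 / r)"
    have "h t \<le> (\<integral>\<^sup>+ s. ennreal (?c / (M * r)) * ennreal (f (t - s) powr p * k s powr q)
          + (ennreal (?c * (1 / p - 1 / r)) * ennreal (f (t - s) powr p)
          + ennreal (?c * (1 / q - 1 / r)) * ennreal (k s powr q)) \<partial>lborel)"
      unfolding h_def
    proof (rule nn_integral_mono)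
      fix s
      have "f (t - s) * k s \<le> ?c / (M * r) * (f (t - s) powr p * k s powr q)
          + (?c * (1 / p - 1 / r) * f (t - s) powr p + ?c * (1 / q - 1 / r) * k s powr q)"
        using young_pointwise[OF pqr nn(1)[of "t - s"] nn(2)[of s] M]
        by (simp add: algebra_simps)
      thus "ennreal (f (t - s) * k s) \<le> ennreal (?c / (M * r)) * ennreal (f (t - s) powr p * k s powr q)
          + (ennreal (?c * (1 / p - 1 / r)) * ennreal (f (t - s) powr p)
          + ennreal (?c * (1 / q - 1 / r)) * ennreal (k s powr q))"
        using w M pqr by (simp add: ennreal_mult[symmetric] ennreal_plus[symmetric] mult_nonneg_nonneg ennreal_leI
             del: ennreal_plus)
    qed
    also have "\<dots> = ennreal (?c / (M * r)) * m t
          + (ennreal (?c * (1 / p - 1 / r)) * (\<integral>\<^sup>+ s. ennreal (f s powr p) \<partial>lborel)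
          + ennreal (?c * (1 / q - 1 / r)) * (\<integral>\<^sup>+ s. ennreal (k s powr q) \<partial>lborel))"
      using nn_integral_lborel_reflect[of "\<lambda>s. ennreal (f s powr p)" t]
      by (simp add: nn_integral_add nn_integral_cmult m_def)
    also have "\<dots> \<le> ennreal (?c / (M * r)) * m t
          + (ennreal (?c * (1 / p - 1 / r)) * 1 + ennreal (?c * (1 / q - 1 / r)) * 1)"
      by (intro add_mono mult_left_mono f1 k1) auto
    also have "\<dots> = ennreal (?c / (M * r) * M + (?c * (1 / p - 1 / r) + ?c * (1 / q - 1 / r)))"
      using w M pqr unfolding mM by (simp add: ennreal_mult[symmetric] ennreal_plus[symmetric] del: ennreal_plus)
    also have "?c / (M * r) * M + (?c * (1 / p - 1 / r) + ?c * (1 / q - 1 / r))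
        = ?c * (1 / p + 1 / q - 1 / r)"
      using M pqr by (simp add: algebra_simps)
    also have "1 / p + 1 / q - 1 / r = 1" using pqr by simp
    finally show ?thesis by (simp add: M_def)
  qed
  show "AE t in lborel. h t < \<infinity>"
    using fin
  proof eventually_elim
    case (elim t)
    show ?case using le_less_trans[OF h_le[OF elim] ennreal_less_top] by simp
  qed
  have "(\<integral>\<^sup>+ t. ennreal (enn2real (h t) powr r) \<partial>lborel) \<le> (\<integral>\<^sup>+ t. m t \<partial>lborel)"
  proof (rule nn_integral_mono_AE, use fin in eventually_elim)
    fix t assume t: "m t \<noteq> \<infinity>"
    have "enn2real (h t) \<le> enn2real (m t) powr (1 / r)"
      using enn2real_mono[OF h_le[OF t]] by simp
    hence "enn2real (h t) powr r \<le> (enn2real (m t) powr (1 / r)) powr r"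
      using pqr by (intro powr_mono2) auto
    also have "\<dots> = enn2real (m t)" using pqr by (simp add: powr_powr)
    finally have "ennreal (enn2real (h t) powr r) \<le> ennreal (enn2real (m t))" by (rule ennreal_leI)
    also have "\<dots> = m t" using t by (simp add: ennreal_enn2real_if)
    finally show "ennreal (enn2real (h t) powr r) \<le> m t" .
  qed
  also note int_m
  finally show "(\<integral>\<^sup>+ t. ennreal (enn2real (h t) powr r) \<partial>lborel) \<le> 1" .
qed

text \<open>Upper bounds \<open>A, B > 0\<close> replace the norms themselves, so that scaling to the normalised
  case never divides by zero.\<close>

lemma young_convolution:
  fixes f k :: "'a::euclidean_space \<Rightarrow> real" and p q r A B :: real
  assumes [measurable]: "f \<in> borel_measurable borel" "k \<in> borel_measurable borel"
    and nn: "\<And>x. f x \<ge> 0" "\<And>x. k x \<ge> 0"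
    and pqr: "p \<ge> 1" "q \<ge> 1" "r \<ge> 1" "1 + 1 / r = 1 / q + 1 / p"
    and AB: "A > 0" "B > 0"
    and fA: "(\<integral>\<^sup>+ x. ennreal (f x powr p) \<partial>lborel) \<le> ennreal (A powr p)"
    and kB: "(\<integral>\<^sup>+ x. ennreal (k x powr q) \<partial>lborel) \<le> ennreal (B powr q)"
  defines "h \<equiv> \<lambda>t. \<integral>\<^sup>+ s. ennreal (f (t - s) * k s) \<partial>lborel"
  shows "AE t in lborel. h t < \<infinity>"
    and "(\<integral>\<^sup>+ t. ennreal (enn2real (h t) powr r) \<partial>lborel) \<le> ennreal ((A * B) powr r)"
proof -
  have scale: "(\<integral>\<^sup>+ x. ennreal ((g x / D) powr e) \<partial>lborel) \<le> 1"
    if "g \<in> borel_measurable borel" "\<And>x. g x \<ge> 0" "D > 0"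
       "(\<integral>\<^sup>+ x. ennreal (g x powr e) \<partial>lborel) \<le> ennreal (D powr e)"
    for g :: "'a \<Rightarrow> real" and D e
  proof -
    note [measurable] = that(1)
    have "(\<integral>\<^sup>+ x. ennreal ((g x / D) powr e) \<partial>lborel)
        = (\<integral>\<^sup>+ x. ennreal (1 / D powr e) * ennreal (g x powr e) \<partial>lborel)"
      using that by (simp add: powr_divide ennreal_mult[symmetric])
    also have "\<dots> = ennreal (1 / D powr e) * (\<integral>\<^sup>+ x. ennreal (g x powr e) \<partial>lborel)"
      by (rule nn_integral_cmult) measurable
    also have "\<dots> \<le> ennreal (1 / D powr e) * ennreal (D powr e)"
      by (rule mult_left_mono[OF that(4)]) simp
    also have "\<dots> = 1" using that by (simp add: ennreal_mult[symmetric])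
    finally show ?thesis .
  qed
  define h1 where "h1 t = (\<integral>\<^sup>+ s. ennreal (f (t - s) / A * (k s / B)) \<partial>lborel)" for t
  have h: "h t = ennreal (A * B) * h1 t" for t
  proof -
    have "h t = (\<integral>\<^sup>+ s. ennreal (A * B) * ennreal (f (t - s) / A * (k s / B)) \<partial>lborel)"
      unfolding h_def using AB nn by (simp add: ennreal_mult[symmetric])
    also have "\<dots> = ennreal (A * B) * h1 t"
      unfolding h1_def by (rule nn_integral_cmult) measurable
    finally show ?thesis .
  qed
  have [measurable]: "h1 \<in> borel_measurable borel" unfolding h1_def by measurable
  note y = young_normalised[of "\<lambda>x. f x / A" "\<lambda>x. k x / B" p q r]
  have "AE t in lborel. h1 t < \<infinity>"
    unfolding h1_def by (rule y(1)) (use nn pqr AB scale fA kB in auto)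
  thus "AE t in lborel. h t < \<infinity>"
    by eventually_elim (simp add: h ennreal_mult_less_top)
  have le1: "(\<integral>\<^sup>+ t. ennreal (enn2real (h1 t) powr r) \<partial>lborel) \<le> 1"
    unfolding h1_def by (rule y(2)) (use nn pqr AB scale fA kB in auto)
  have "(\<integral>\<^sup>+ t. ennreal (enn2real (h t) powr r) \<partial>lborel)
      = (\<integral>\<^sup>+ t. ennreal ((A * B) powr r) * ennreal (enn2real (h1 t) powr r) \<partial>lborel)"
    using AB by (simp add: h enn2real_mult powr_mult ennreal_mult[symmetric])
  also have "\<dots> = ennreal ((A * B) powr r) * (\<integral>\<^sup>+ t. ennreal (enn2real (h1 t) powr r) \<partial>lborel)"
    by (rule nn_integral_cmult) measurable
  also have "\<dots> \<le> ennreal ((A * B) powr r) * 1" by (rule mult_left_mono[OF le1]) simp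
  finally show "(\<integral>\<^sup>+ t. ennreal (enn2real (h t) powr r) \<partial>lborel) \<le> ennreal ((A * B) powr r)" by simp
qed

section \<open>Convolution of complex-valued Lebesgue measurable functions\<close>

lemma nn_integral_le_of_Lp_norm_le:
  fixes f :: "real^'n \<Rightarrow> complex"
  assumes "p > 0" "A \<ge> 0" "Lp_norm p f \<le> ennreal A"
  shows "(\<integral>\<^sup>+ x. ennreal (norm (f x) powr p) \<partial>lborel) \<le> ennreal (A powr p)"
proof -
  define I where "I = (\<integral>\<^sup>+ x. ennreal (norm (f x) powr p) \<partial>lborel)"
  have N: "Lp_norm p f = (if I = \<infinity> then \<infinity> else ennreal (enn2real I powr (1 / p)))"
    unfolding Lp_norm_def Let_def nn_integral_completion I_def ..
  have I: "I \<noteq> \<infinity>" using assms(3) unfolding N by (auto simp: top_unique)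
  hence "enn2real I powr (1 / p) \<le> A"
    using assms(2,3) unfolding N by (simp add: ennreal_le_iff)
  hence "(enn2real I powr (1 / p)) powr p \<le> A powr p" using assms by (intro powr_mono2) auto
  hence "enn2real I \<le> A powr p" using assms by (simp add: powr_powr)
  hence "ennreal (enn2real I) \<le> ennreal (A powr p)" by (rule ennreal_leI)
  thus ?thesis using I unfolding I_def[symmetric] by (simp add: ennreal_enn2real_if)
qed

lemma Lp_norm_le_of_nn_integral_le:
  fixes f :: "real^'n \<Rightarrow> complex"
  assumes "p > 0" "A \<ge> 0" "(\<integral>\<^sup>+ x. ennreal (norm (f x) powr p) \<partial>lborel) \<le> ennreal (A powr p)"
  shows "Lp_norm p f \<le> ennreal A"
proof -
  define I where "I = (\<integral>\<^sup>+ x. ennreal (norm (f x) powr p) \<partial>lborel)"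
  have le: "I \<le> ennreal (A powr p)" using assms(3) by (simp add: I_def)
  have I: "I \<noteq> \<infinity>" using le by (auto simp: top_unique)
  have "enn2real I \<le> A powr p" using enn2real_mono[OF le] by simp
  hence "enn2real I powr (1 / p) \<le> (A powr p) powr (1 / p)" using assms by (intro powr_mono2) auto
  hence "enn2real I powr (1 / p) \<le> A" using assms by (simp add: powr_powr)
  thus ?thesis
    using I unfolding Lp_norm_def Let_def nn_integral_completion I_def[symmetric]
    by (simp add: ennreal_leI)
qed

definition kernel_conv :: "(real^'n \<Rightarrow> complex) \<Rightarrow> (real^'n \<Rightarrow> real) \<Rightarrow> real^'n \<Rightarrow> complex" where
  "kernel_conv f k t = (\<integral>s. f (t - s) * complex_of_real (k s) \<partial>lebesgue)"

lemma lebesgue_measurable_complex_ex_borel: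
  fixes f :: "'a::euclidean_space \<Rightarrow> complex"
  assumes [measurable]: "f \<in> borel_measurable lebesgue"
  shows "\<exists>g \<in> borel_measurable borel. AE x in lborel. f x = g x"
proof -
  obtain g1 where g1: "g1 \<in> borel_measurable lborel" "AE x in lborel. Re (f x) = g1 x"
    using completion_ex_borel_measurable_real[of "\<lambda>x. Re (f x)" lborel] by auto
  obtain g2 where g2: "g2 \<in> borel_measurable lborel" "AE x in lborel. Im (f x) = g2 x"
    using completion_ex_borel_measurable_real[of "\<lambda>x. Im (f x)" lborel] by auto
  note [measurable] = g1(1) g2(1)
  have "(\<lambda>x. complex_of_real (g1 x) + \<i> * complex_of_real (g2 x)) \<in> borel_measurable borel" by measurable
  moreover have "AE x in lborel. f x = complex_of_real (g1 x) + \<i> * complex_of_real (g2 x)"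
    using g1(2) g2(2) by eventually_elim (simp add: complex_eq_iff)
  ultimately show ?thesis
    by (intro bexI[of _ "\<lambda>x. complex_of_real (g1 x) + \<i> * complex_of_real (g2 x)"])
qed

text \<open>Tonelli's theorem is applied on the Borel product space, whereas \<open>f\<close> is only Lebesgue
  measurable. Changing \<open>f\<close> on a null set changes no value of the convolution, because
  \<open>s \<mapsto> t - s\<close> preserves null sets.\<close>

lemma kernel_conv_borel_representative:
  fixes f :: "real^'n \<Rightarrow> complex"
  assumes f: "f \<in> borel_measurable lebesgue" and [measurable]: "k \<in> borel_measurable borel"
  obtains g where "g \<in> borel_measurable borel" "AE x in lborel. f x = g x"
    "\<And>t. kernel_conv f k t = (\<integral>s. g (t - s) * complex_of_real (k s) \<partial>lborel)"
    "\<And>t. integrable lebesgue (\<lambda>s. f (t - s) * complex_of_real (k s)) \<longleftrightarrow>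
         integrable lborel (\<lambda>s. g (t - s) * complex_of_real (k s))"
proof -
  obtain g where g[measurable]: "g \<in> borel_measurable borel" and fg: "AE x in lborel. f x = g x"
    using lebesgue_measurable_complex_ex_borel[OF f] by blast
  have ae: "AE s in lebesgue. g (t - s) * complex_of_real (k s) = f (t - s) * complex_of_real (k s)" for t
    using AE_lborel_reflect[OF fg, of t] unfolding AE_completion_iff by eventually_elim simp
  have ae': "AE s in lebesgue. f (t - s) * complex_of_real (k s) = g (t - s) * complex_of_real (k s)" for t
    using AE_lborel_reflect[OF fg, of t] unfolding AE_completion_iff by eventually_elim simp
  have gm: "(\<lambda>s. g (t - s) * complex_of_real (k s)) \<in> borel_measurable lebesgue" for t
    by (rule measurable_completion) measurable
  have fm: "(\<lambda>s. f (t - s) * complex_of_real (k s)) \<in> borel_measurable lebesgue" for t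
    by (rule borel_measurable_AE[OF gm ae])
  have "kernel_conv f k t = (\<integral>s. g (t - s) * complex_of_real (k s) \<partial>lborel)" for t
  proof -
    have "kernel_conv f k t = (\<integral>s. g (t - s) * complex_of_real (k s) \<partial>lebesgue)"
      unfolding kernel_conv_def by (rule integral_cong_AE[OF fm gm]) (rule ae'[of t])
    also have "\<dots> = (\<integral>s. g (t - s) * complex_of_real (k s) \<partial>lborel)"
      by (rule integral_completion) measurable
    finally show ?thesis .
  qed
  moreover have "integrable lebesgue (\<lambda>s. f (t - s) * complex_of_real (k s)) \<longleftrightarrow>
          integrable lborel (\<lambda>s. g (t - s) * complex_of_real (k s))" for t
  proof -
    have "integrable lebesgue (\<lambda>s. f (t - s) * complex_of_real (k s)) \<longleftrightarrow>
          integrable lebesgue (\<lambda>s. g (t - s) * complex_of_real (k s))"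
      by (rule integrable_cong_AE[OF fm gm]) (rule ae'[of t])
    also have "\<dots> \<longleftrightarrow> integrable lborel (\<lambda>s. g (t - s) * complex_of_real (k s))"
      by (rule integrable_completion) measurable
    finally show ?thesis .
  qed
  ultimately show ?thesis by (rule that[OF g fg])
qed

lemma lebesgue_measurable_kernel_conv:
  fixes f :: "real^'n \<Rightarrow> complex"
  assumes f: "f \<in> borel_measurable lebesgue" and k[measurable]: "k \<in> borel_measurable borel"
  shows "kernel_conv f k \<in> borel_measurable lebesgue"
proof -
  obtain g where [measurable]: "g \<in> borel_measurable borel" and fg: "AE x in lborel. f x = g x"
    and g: "\<And>t. kernel_conv f k t = (\<integral>s. g (t - s) * complex_of_real (k s) \<partial>lborel)"
    and i: "\<And>t. integrable lebesgue (\<lambda>s. f (t - s) * complex_of_real (k s)) \<longleftrightarrow>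
          integrable lborel (\<lambda>s. g (t - s) * complex_of_real (k s))"
    by (rule kernel_conv_borel_representative[OF f k]) (rule that; assumption)
  have "(\<lambda>t. \<integral>s. g (t - s) * complex_of_real (k s) \<partial>lborel) \<in> borel_measurable lborel"
    by measurable
  hence "kernel_conv f k \<in> borel_measurable lborel" by (subst measurable_cong[OF g])
  thus ?thesis by (rule measurable_completion)
qed

text \<open>The real inequality is applied to the absolute values; their convolution is finite almost
  everywhere, which is the absolute convergence of the complex integral.\<close>

lemma young_kernel_conv:
  fixes f :: "real^'n \<Rightarrow> complex" and k :: "real^'n \<Rightarrow> real"
  assumes f: "f \<in> borel_measurable lebesgue" and k[measurable]: "k \<in> borel_measurable borel"
    and pqr: "p \<ge> 1" "q \<ge> 1" "r \<ge> 1" "1 + 1 / r = 1 / q + 1 / p"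
    and B: "B > 0" "(\<integral>\<^sup>+ z. ennreal (\<bar>k z\<bar> powr q) \<partial>lborel) \<le> ennreal (B powr q)"
    and fin: "Lp_norm p f < \<infinity>"
  shows "AE t in lebesgue. integrable lebesgue (\<lambda>s. f (t - s) * complex_of_real (k s))"
    and "Lp_norm r (kernel_conv f k) \<le> ennreal B * Lp_norm p f"
proof -
  obtain g where [measurable]: "g \<in> borel_measurable borel" and fg: "AE x in lborel. f x = g x"
    and g: "\<And>t. kernel_conv f k t = (\<integral>s. g (t - s) * complex_of_real (k s) \<partial>lborel)"
    and i: "\<And>t. integrable lebesgue (\<lambda>s. f (t - s) * complex_of_real (k s)) \<longleftrightarrow>
          integrable lborel (\<lambda>s. g (t - s) * complex_of_real (k s))"
    by (rule kernel_conv_borel_representative[OF f k]) (rule that; assumption)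
  define h where "h t = (\<integral>\<^sup>+ s. ennreal (norm (g (t - s)) * \<bar>k s\<bar>) \<partial>lborel)" for t
  have int: "integrable lborel (\<lambda>s. g (t - s) * complex_of_real (k s))" if "h t < \<infinity>" for t
    using that unfolding h_def by (subst integrable_iff_bounded) (simp add: norm_mult)
  have norm_le: "norm (kernel_conv f k t) \<le> enn2real (h t)" if "h t < \<infinity>" for t
  proof -
    have "ennreal (norm (kernel_conv f k t)) \<le> h t"
      using integral_norm_bound_ennreal[OF int[OF that]] by (simp add: g h_def norm_mult)
    from enn2real_mono[OF this] that show ?thesis by simp
  qed
  have bound: "(AE t in lborel. h t < \<infinity>) \<and> Lp_norm r (kernel_conv f k) \<le> ennreal (A * B)"
    if A: "A > 0" "Lp_norm p f \<le> ennreal A" for A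
  proof -
    have "(\<integral>\<^sup>+ x. ennreal (norm (g x) powr p) \<partial>lborel) = (\<integral>\<^sup>+ x. ennreal (norm (f x) powr p) \<partial>lborel)"
      by (rule nn_integral_cong_AE) (use fg in eventually_elim, simp)
    also have "\<dots> \<le> ennreal (A powr p)" using A pqr by (intro nn_integral_le_of_Lp_norm_le) auto
    finally have gA: "(\<integral>\<^sup>+ x. ennreal (norm (g x) powr p) \<partial>lborel) \<le> ennreal (A powr p)" .
    have y: "AE t in lborel. h t < \<infinity>"
            "(\<integral>\<^sup>+ t. ennreal (enn2real (h t) powr r) \<partial>lborel) \<le> ennreal ((A * B) powr r)"
      unfolding h_def
      by (rule young_convolution[of "\<lambda>x. norm (g x)" "\<lambda>x. \<bar>k x\<bar>" p q r A B, OF _ _ _ _ pqr A(1) B(1) gA B(2)];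
          simp)+
    have "(\<integral>\<^sup>+ t. ennreal (norm (kernel_conv f k t) powr r) \<partial>lborel)
        \<le> (\<integral>\<^sup>+ t. ennreal (enn2real (h t) powr r) \<partial>lborel)"
    proof (rule nn_integral_mono_AE, use y(1) in eventually_elim)
      fix t assume "h t < \<infinity>"
      thus "ennreal (norm (kernel_conv f k t) powr r) \<le> ennreal (enn2real (h t) powr r)"
        using norm_le[of t] pqr by (intro ennreal_leI powr_mono2) auto
    qed
    also note y(2)
    finally show ?thesis
      using y(1) A(1) B(1) pqr by (intro conjI Lp_norm_le_of_nn_integral_le) auto
  qed
  define a where "a = enn2real (Lp_norm p f)"
  have a: "Lp_norm p f = ennreal a" "a \<ge> 0" using fin by (auto simp: a_def ennreal_enn2real_if)
  have "AE t in lborel. h t < \<infinity>"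
    using bound[of "a + 1"] a by (simp add: ennreal_leI)
  hence "AE t in lborel. integrable lebesgue (\<lambda>s. f (t - s) * complex_of_real (k s))"
    by eventually_elim (simp add: i int)
  thus "AE t in lebesgue. integrable lebesgue (\<lambda>s. f (t - s) * complex_of_real (k s))"
    by (rule AE_completion)
  show "Lp_norm r (kernel_conv f k) \<le> ennreal B * Lp_norm p f"
  (* A vanishing norm of f is not a positive bound A, so the estimate is obtained in the limit
     A \<rightarrow> a from above. *)
  proof (rule ennreal_le_epsilon)
    fix e :: real assume e: "e > 0"
    have "Lp_norm r (kernel_conv f k) \<le> ennreal ((a + e / B) * B)"
      using bound[of "a + e / B"] a e B(1) by (simp add: ennreal_leI add_nonneg_pos)
    also have "(a + e / B) * B = B * a + e" using B(1) by (simp add: field_simps)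
    also have "ennreal \<dots> = ennreal B * Lp_norm p f + ennreal e"
      using a e B(1) by (simp add: ennreal_mult ennreal_plus)
    finally show "Lp_norm r (kernel_conv f k) \<le> ennreal B * Lp_norm p f + ennreal e" .
  qed
qed

section \<open>The Bochner-Riesz operator on Grand Lebesgue Spaces\<close>

lemma bochner_riesz_eq_kernel_conv: "bochner_riesz \<alpha> R f = kernel_conv f (br_kernel \<alpha> R)"
  by (simp add: fun_eq_iff bochner_riesz_def kernel_conv_def)

text \<open>One constant serves all exponents: \<open>W\<close> is the kernel bound rewritten in terms of \<open>p\<close> and \<open>r\<close>
  by \<open>1 - 1/q = 1/p - 1/r\<close>.\<close>

lemma bochner_riesz_Lp_Lr:
  assumes "\<alpha> > -1" "R > 0"
  shows "\<exists>C>0. \<forall>(f :: real^'n \<Rightarrow> complex) p r.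
     f \<in> borel_measurable lebesgue \<longrightarrow> admissible \<alpha> CARD('n) p r \<longrightarrow> Lp_norm p f < \<infinity> \<longrightarrow>
       bochner_riesz_defined \<alpha> R f \<and>
       Lp_norm r (bochner_riesz \<alpha> R f) \<le> ennreal (C * W \<alpha> CARD('n) R p r) * Lp_norm p f"
proof -
  obtain C where C: "C > 0" and K: "\<And>q. q \<ge> 1 \<Longrightarrow> q > q0 \<alpha> CARD('n) \<Longrightarrow>
     (\<integral>\<^sup>+ (z::real^'n). ennreal (\<bar>br_kernel \<alpha> R z\<bar> powr q) \<partial>lborel)
       \<le> ennreal ((C * R powr (real CARD('n) * (1 - 1 / q)) * (q - q0 \<alpha> CARD('n)) powr - (1 / q)) powr q)"
    using br_kernel_Lq_bound[OF assms, where 'n='n] by blast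
  show ?thesis
  proof (intro exI[of _ C] conjI[OF C] allI impI)
    fix f :: "real^'n \<Rightarrow> complex" and p r
    assume f: "f \<in> borel_measurable lebesgue" and adm: "admissible \<alpha> CARD('n) p r"
      and fin: "Lp_norm p f < \<infinity>"
    define q where "q = q_exp p r"
    have pqr: "p > 1" "q \<ge> 1" "r \<ge> 1" "q > q0 \<alpha> CARD('n)"
      using adm by (auto simp: admissible_def q_def)
    have "p * r + p - r \<noteq> 0"
      using pqr(2) by (auto simp: q_def q_exp_def)
    hence inv_q: "1 / q = 1 + 1 / r - 1 / p"
      using pqr unfolding q_def q_exp_def by (simp add: field_simps)
    have B: "C * W \<alpha> CARD('n) R p r
        = C * R powr (real CARD('n) * (1 - 1 / q)) * (q - q0 \<alpha> CARD('n)) powr - (1 / q)"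
    proof -
      have e: "1 - 1 / q = 1 / p - 1 / r" "- (1 / q) = 1 / p - 1 - 1 / r" using inv_q by simp_all
      show ?thesis unfolding e by (simp only: W_def q_def mult.assoc)
    qed
    have Bpos: "C * W \<alpha> CARD('n) R p r > 0"
      unfolding B using C assms pqr by simp
    have scal: "1 + 1 / r = 1 / q + 1 / p" using inv_q by simp
    note Y = young_kernel_conv[OF f borel_measurable_br_kernel[OF assms] _ pqr(2,3) scal Bpos _ fin]
    have "bochner_riesz_defined \<alpha> R f"
      unfolding bochner_riesz_defined_def
      by (rule Y(1)) (use pqr K[OF pqr(2,4)] in \<open>simp_all add: B\<close>)
    moreover have "Lp_norm r (bochner_riesz \<alpha> R f) \<le> ennreal (C * W \<alpha> CARD('n) R p r) * Lp_norm p f"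
      unfolding bochner_riesz_eq_kernel_conv
      by (rule Y(2)) (use pqr K[OF pqr(2,4)] in \<open>simp_all add: B\<close>)
    ultimately show "bochner_riesz_defined \<alpha> R f \<and>
       Lp_norm r (bochner_riesz \<alpha> R f) \<le> ennreal (C * W \<alpha> CARD('n) R p r) * Lp_norm p f" ..
  qed
qed

lemma ennreal_le_mult_of_divide_le:
  fixes a b c :: ennreal
  assumes "a / b \<le> c" "b \<noteq> 0" "b < \<infinity>"
  shows "a \<le> c * b"
proof -
  have "a = a / b * b" using assms by (simp add: ennreal_divide_times ennreal_divide_self)
  also have "\<dots> \<le> c * b" using assms(1) by (rule mult_right_mono) simp
  finally show ?thesis .
qed

lemma W_pos: "R > 0 \<Longrightarrow> admissible \<alpha> n p r \<Longrightarrow> W \<alpha> n R p r > 0"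
  by (simp add: W_def admissible_def)

lemma Lp_norm_le_GLS_norm:
  assumes "p \<in> I" "\<psi> p \<noteq> 0" "\<psi> p < \<infinity>"
  shows "Lp_norm p f \<le> GLS_norm I \<psi> f * \<psi> p"
proof (rule ennreal_le_mult_of_divide_le[OF _ assms(2,3)])
  show "Lp_norm p f / \<psi> p \<le> GLS_norm I \<psi> f"
    unfolding GLS_norm_def by (rule SUP_upper[OF assms(1)])
qed

theorem theorem3p1:
  fixes \<alpha> R :: real
  assumes "CARD('n::finite) > 1"
    and "R > 0"
    and "- 1 < \<alpha>"
    and "\<alpha> \<le> (real CARD('n) - 1) / 2"
  shows "\<exists>C>0. \<forall>(a::real) (b::ereal) (\<psi> :: real \<Rightarrow> ennreal) (f :: real^'n \<Rightarrow> complex).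
           1 \<le> a \<longrightarrow> ereal a < b \<longrightarrow>
           generating_function (exponents a b) \<psi> \<longrightarrow>
           f \<in> GLS (exponents a b) \<psi> \<longrightarrow>
             ((\<exists>r \<in> nu_range \<alpha> CARD('n) b. nu \<alpha> CARD('n) R a b \<psi> r < \<infinity>) \<longrightarrow>
                bochner_riesz_defined \<alpha> R f) \<and>
             bochner_riesz \<alpha> R f \<in> GLS (nu_range \<alpha> CARD('n) b) (nu \<alpha> CARD('n) R a b \<psi>) \<and>
             GLS_norm (nu_range \<alpha> CARD('n) b) (nu \<alpha> CARD('n) R a b \<psi>) (bochner_riesz \<alpha> R f)
               \<le> ennreal C * GLS_norm (exponents a b) \<psi> f"
proof -
  note R = assms(2) and \<alpha> = assms(3)
  obtain C where C: "C > 0"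
    and key: "\<And>(f :: real^'n \<Rightarrow> complex) p r.
     f \<in> borel_measurable lebesgue \<Longrightarrow> admissible \<alpha> CARD('n) p r \<Longrightarrow> Lp_norm p f < \<infinity> \<Longrightarrow>
       bochner_riesz_defined \<alpha> R f \<and>
       Lp_norm r (bochner_riesz \<alpha> R f) \<le> ennreal (C * W \<alpha> CARD('n) R p r) * Lp_norm p f"
    using bochner_riesz_Lp_Lr[OF \<alpha> R, where 'n='n] by blast
  show ?thesis
  proof (rule exI[of _ C], rule conjI[OF C], intro allI impI)
    fix a :: real and b :: ereal and \<psi> :: "real \<Rightarrow> ennreal" and f :: "real^'n \<Rightarrow> complex"
    assume gen: "generating_function (exponents a b) \<psi>" and f: "f \<in> GLS (exponents a b) \<psi>"
    let ?n = "CARD('n)" and ?N = "GLS_norm (exponents a b) \<psi> f" and ?B = "bochner_riesz \<alpha> R f"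
    let ?\<nu> = "nu \<alpha> ?n R a b \<psi>"
    let ?P = "\<lambda>r. {p \<in> exponents a (s_exp \<alpha> ?n b r). admissible \<alpha> ?n p r}"
    have fm: "f \<in> borel_measurable lebesgue" and N: "?N < \<infinity>" using f by (auto simp: GLS_def)
    have \<psi>_le: "Lp_norm p f \<le> ?N * \<psi> p" if "p \<in> ?P r" "\<psi> p < \<infinity>" for p r
    proof (rule Lp_norm_le_GLS_norm)
      show p: "p \<in> exponents a b" using that by (auto simp: exponents_def s_exp_def)
      show "\<psi> p \<noteq> 0" using gen p by (auto simp: generating_function_def)
    qed fact
    have est: "bochner_riesz_defined \<alpha> R f \<and> Lp_norm r ?B \<le> ennreal C * ?N * (ennreal (W \<alpha> ?n R p r) * \<psi> p)"
      if p: "p \<in> ?P r" and fin: "\<psi> p < \<infinity>" for p r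
    proof -
      have "Lp_norm p f < \<infinity>"
        using \<psi>_le[OF p fin] N fin by (auto simp: ennreal_mult_less_top intro: le_less_trans)
      hence *: "bochner_riesz_defined \<alpha> R f"
        "Lp_norm r ?B \<le> ennreal (C * W \<alpha> ?n R p r) * Lp_norm p f"
        using key[OF fm, of p r] p by auto
      note *(2)
      also have "ennreal (C * W \<alpha> ?n R p r) * Lp_norm p f \<le> ennreal (C * W \<alpha> ?n R p r) * (?N * \<psi> p)"
        by (rule mult_left_mono[OF \<psi>_le[OF p fin]]) simp
      also have "\<dots> = ennreal C * ?N * (ennreal (W \<alpha> ?n R p r) * \<psi> p)"
        using C W_pos[OF R, of \<alpha> ?n p r] p by (simp add: ennreal_mult mult_ac)
      finally show ?thesis using *(1) by blast
    qed
    (* Where \<psi> is infinite, \<parallel>f\<parallel>\<^sub>p may be infinite as well and there is no estimate; since W > 0, such p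
       contribute \<infinity> to the infimum and do not affect it. *)
    have finite_\<psi>: "\<exists>p\<in>?P r. \<psi> p < \<infinity>" if "?\<nu> r < \<infinity>" for r
    proof -
      have "\<exists>p\<in>?P r. ennreal (W \<alpha> ?n R p r) * \<psi> p < \<infinity>"
        using that unfolding nu_def INF_less_iff .
      then obtain p where p: "p \<in> ?P r" "ennreal (W \<alpha> ?n R p r) * \<psi> p < \<infinity>"
        by (rule bexE)
      have "W \<alpha> ?n R p r > 0" using W_pos[OF R] p by auto
      hence "\<psi> p < \<infinity>" using p(2) by (auto simp: ennreal_mult_less_top)
      thus ?thesis using p(1) by blast
    qed
    have le_\<nu>: "Lp_norm r ?B \<le> ennreal C * ?N * ?\<nu> r" if \<nu>: "?\<nu> r < \<infinity>" for r
    (* If the norm of f is positive, divide by C ?N and compare with each term of the infimum; if it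
       is zero, a single term with finite \<psi> already forces the left-hand side to vanish. *)
    proof (cases "?N = 0")
      case True
      obtain p where p: "p \<in> ?P r" "\<psi> p < \<infinity>" using finite_\<psi>[OF \<nu>] by blast
      have "Lp_norm r ?B \<le> ennreal C * ?N * (ennreal (W \<alpha> ?n R p r) * \<psi> p)"
        using est[OF p] by blast
      thus ?thesis by (simp add: True)
    next
      case False
      let ?c = "ennreal C * ?N"
      have c: "?c \<noteq> 0" "?c < \<infinity>" using C N False by (auto simp: ennreal_mult_less_top)
      have "Lp_norm r ?B / ?c \<le> ?\<nu> r"
        unfolding nu_def
      proof (rule INF_greatest)
        fix p assume p: "p \<in> ?P r"
        have W: "W \<alpha> ?n R p r > 0" using W_pos[OF R] p by auto
        show "Lp_norm r ?B / ?c \<le> ennreal (W \<alpha> ?n R p r) * \<psi> p"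
        proof (cases "\<psi> p < \<infinity>")
          case True
          show ?thesis
            using est[OF p True] c by (intro divide_le_posI_ennreal) (auto simp: zero_less_iff_neq_zero)
        next
          case False
          hence "ennreal (W \<alpha> ?n R p r) * \<psi> p = \<infinity>"
            using W by (simp add: ennreal_mult_eq_top_iff less_top[symmetric])
          thus ?thesis by simp
        qed
      qed
      hence "Lp_norm r ?B \<le> ?\<nu> r * ?c" by (rule ennreal_le_mult_of_divide_le) (use c in auto)
      thus ?thesis by (simp only: mult.commute)
    qed
    have norm_le: "GLS_norm (nu_range \<alpha> ?n b) ?\<nu> ?B \<le> ennreal C * ?N"
      unfolding GLS_norm_def
    proof (rule SUP_least)
      fix r
      show "Lp_norm r ?B / ?\<nu> r \<le> ennreal C * (SUP p\<in>exponents a b. Lp_norm p f / \<psi> p)"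
        unfolding GLS_norm_def[symmetric]
      proof (cases "?\<nu> r < \<infinity>")
        case False
        hence "?\<nu> r = \<infinity>" by (simp add: less_top[symmetric])
        thus "Lp_norm r ?B / ?\<nu> r \<le> ennreal C * ?N" by simp
      next
        case True
        show "Lp_norm r ?B / ?\<nu> r \<le> ennreal C * ?N"
        proof (cases "?\<nu> r = 0")
          (* The quotient 0 / 0 is 0 in the extended nonnegative reals. *)
          case 0: True
          hence "Lp_norm r ?B = 0" using le_\<nu>[OF True] by simp
          thus ?thesis by simp
        next
          case False
          moreover have "Lp_norm r ?B \<le> ?\<nu> r * (ennreal C * ?N)"
            using le_\<nu>[OF True] by (simp only: mult.commute)
          ultimately show ?thesis
            by (intro divide_le_posI_ennreal) (auto simp: zero_less_iff_neq_zero)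
        qed
      qed
    qed
    have "?B \<in> borel_measurable lebesgue"
      unfolding bochner_riesz_eq_kernel_conv
      by (rule lebesgue_measurable_kernel_conv[OF fm borel_measurable_br_kernel[OF \<alpha> R]])
    moreover have "GLS_norm (nu_range \<alpha> ?n b) ?\<nu> ?B < \<infinity>"
      using le_less_trans[OF norm_le] N by (simp add: ennreal_mult_less_top)
    moreover have "(\<exists>r \<in> nu_range \<alpha> ?n b. ?\<nu> r < \<infinity>) \<longrightarrow> bochner_riesz_defined \<alpha> R f"
      using finite_\<psi> est by blast
    ultimately show "((\<exists>r \<in> nu_range \<alpha> ?n b. ?\<nu> r < \<infinity>) \<longrightarrow> bochner_riesz_defined \<alpha> R f) \<and>
             ?B \<in> GLS (nu_range \<alpha> ?n b) ?\<nu> \<and> GLS_norm (nu_range \<alpha> ?n b) ?\<nu> ?B \<le> ennreal C * ?N"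
      using norm_le by (simp add: GLS_def)
  qed
qed

end
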